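(* Let $D_4=(V,A)$ be the digraph with vertex set $V=\{v_1,v_2,v_3,v_4,v_5,v_6\}$ and arc set $A=\{(v_2,v_1),(v_2,v_3),(v_4,v_1),(v_4,v_3),(v_5,v_2),(v_5,v_3),(v_5,v_4),(v_6,v_1),(v_6,v_2),(v_6,v_3)\}$ (where $v_1,\dots,v_6$ represent holomorphic, CR, anti-invariant, slant, semi-slant and hemi-slant submanifolds of almost Hermitian manifolds, respectively). Then: (i) $D_4$ is a three-partite digraph; (ii) $D_4$ has a perfect matching; (iii) the independence number of $D_4$ is $2$; (iv) the chromatic number of $D_4$ is $3$; (v) $D_4$ has no directed spanning tree; (vi) the domination number of $D_4$ is $2$.
   Context: An arc $(u,v)$ goes from $u$ to $v$. The geometric meaning of the vertices plays no role in the statement; the digraph is the explicit one given. Definitions for a digraph $D=(V,A)$: - $D$ is $p$-partite if $V$ can be partitioned into $p$ nonempty sets such that no arc joins two vertices of the same set. - A matching is a set of arcs, none a loop, no two of which share an end-vertex. A perfect matching is a matching with $|V|/2$ arcs. - A set of vertices is independent if there are no arcs between its members. The independence number is the maximum size of an independent set. The chromatic number is the minimum number of sets in a partition of $V$ into independent sets. - A directed spanning tree of $D$ with root $r\in V$ is a subdigraph $T$ of $D$ with $V(T)=V$ whose underlying undirected graph is a tree and in which there is a unique directed path from $r$ to each $v\in V\setminus\{r\}$. "$D$ has a directed spanning tree" means one exists for some root $r$. - A dominating set is a set $S\subseteq V$ such that for every $v\in V\setminus S$ there is $u\in S$ with $(u,v)\in A$. The domination number is the minimum cardinality of a dominating set.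 *)

theory Defs
  imports "Graph_Theory.Graph_Theory" "HOL-Library.Disjoint_Sets"
begin

text \<open>
  The digraph invariants below are meant for finite digraphs: \<^const>\<open>Max\<close>, \<^const>\<open>Min\<close> and
  \<^const>\<open>card\<close> carry no information on infinite sets. The chromatic number moreover presupposes
  that there are no loops, since otherwise no partition into independent sets exists.
\<close>

definition independent_set :: "('a,'b) pre_digraph \<Rightarrow> 'a set \<Rightarrow> bool" where
  "independent_set D S \<longleftrightarrow> S \<subseteq> verts D \<and> (\<forall>u\<in>S. \<forall>v\<in>S. (u, v) \<notin> arcs_ends D)"

definition independent_partition :: "('a,'b) pre_digraph \<Rightarrow> 'a set set \<Rightarrow> bool" where
  "independent_partition D P \<longleftrightarrow>
     partition_on (verts D) P \<and> finite P \<and> (\<forall>X\<in>P. independent_set D X)"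

text \<open>The parts are nonempty by definition of \<^const>\<open>partition_on\<close>.\<close>

definition multipartite :: "nat \<Rightarrow> ('a,'b) pre_digraph \<Rightarrow> bool" where
  "multipartite p D \<longleftrightarrow> (\<exists>P. independent_partition D P \<and> card P = p)"

definition matching :: "('a,'b) pre_digraph \<Rightarrow> 'b set \<Rightarrow> bool" where
  "matching D M \<longleftrightarrow> M \<subseteq> arcs D \<and> (\<forall>e\<in>M. tail D e \<noteq> head D e) \<and>
     (\<forall>e\<in>M. \<forall>f\<in>M. e \<noteq> f \<longrightarrow> {tail D e, head D e} \<inter> {tail D f, head D f} = {})"

text \<open>The factor 2 avoids truncating division when the number of vertices is odd.\<close>

definition perfect_matching :: "('a,'b) pre_digraph \<Rightarrow> 'b set \<Rightarrow> bool" where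
  "perfect_matching D M \<longleftrightarrow> matching D M \<and> 2 * card M = card (verts D)"

definition independence_number :: "('a,'b) pre_digraph \<Rightarrow> nat" where
  "independence_number D = Max (card ` {S. independent_set D S})"

definition chromatic_number :: "('a,'b) pre_digraph \<Rightarrow> nat" where
  "chromatic_number D = Min (card ` {P. independent_partition D P})"

text \<open>
  The library's \<^const>\<open>tree\<close> is not the right notion here: it excludes directed cycles only, so
  it holds of a transitive tournament, and it fails for every symmetric digraph with an arc. In
  the symmetric digraph \<^const>\<open>mk_symmetric\<close> that represents the underlying undirected graph,
  an edge gives rise to a closed walk of length 2; undirected cycles of a loopfree graph are the
  cycles of length at least 3.
\<close>

definition underlying_tree :: "('a,'b) pre_digraph \<Rightarrow> bool" where
  "underlying_tree T \<longleftrightarrow> loopfree_digraph T \<and> connected T \<and>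
     \<not> (\<exists>p. pre_digraph.cycle (with_proj (mk_symmetric T)) p \<and> 3 \<le> length p)"

definition directed_spanning_tree ::
  "('a,'b) pre_digraph \<Rightarrow> ('a,'b) pre_digraph \<Rightarrow> 'a \<Rightarrow> bool" where
  "directed_spanning_tree D T r \<longleftrightarrow> r \<in> verts D \<and> spanning T D \<and> underlying_tree T \<and>
     (\<forall>v \<in> verts D - {r}. \<exists>!p. pre_digraph.apath T r p v)"

definition has_directed_spanning_tree :: "('a,'b) pre_digraph \<Rightarrow> bool" where
  "has_directed_spanning_tree D \<longleftrightarrow> (\<exists>T r. directed_spanning_tree D T r)"

definition dominating_set :: "('a,'b) pre_digraph \<Rightarrow> 'a set \<Rightarrow> bool" where
  "dominating_set D S \<longleftrightarrow>
     S \<subseteq> verts D \<and> (\<forall>v \<in> verts D - S. \<exists>u\<in>S. (u, v) \<in> arcs_ends D)"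

definition domination_number :: "('a,'b) pre_digraph \<Rightarrow> nat" where
  "domination_number D = Min (card ` {S. dominating_set D S})"

text \<open>
  The vertices stand for the classes of holomorphic, CR, anti-invariant, slant, semi-slant and
  hemi-slant submanifolds of almost Hermitian manifolds, in this order.
\<close>

datatype vertex = v1 | v2 | v3 | v4 | v5 | v6

definition D4 :: "(vertex, vertex \<times> vertex) pre_digraph" where
  "D4 = with_proj
     \<lparr> pverts = {v1, v2, v3, v4, v5, v6},
       parcs = {(v2, v1), (v2, v3), (v4, v1), (v4, v3), (v5, v2), (v5, v3), (v5, v4),
                (v6, v1), (v6, v2), (v6, v3)} \<rparr>"

lemma digraph_D4: "digraph D4"
  by unfold_locales (auto simp: D4_def arc_to_ends_def)

end

theory Submission
  imports Defs
begin

text \<open>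
  The vertices \<^const>\<open>v5\<close> and \<^const>\<open>v6\<close> have no incoming arc, so both belong to every dominating set
  and no root can reach both of them. The vertices \<^const>\<open>v1\<close>, \<^const>\<open>v2\<close>, \<^const>\<open>v6\<close> are pairwise
  adjacent, so three colours are needed. The non-adjacent pairs \<^term>\<open>{v1, v3}\<close>, \<^term>\<open>{v1, v5}\<close>,
  \<^term>\<open>{v5, v6}\<close>, \<^term>\<open>{v4, v6}\<close>, \<^term>\<open>{v2, v4}\<close> form a path, hence contain no triangle.
\<close>

text \<open>\<open>Max_eqI\<close> and \<open>Min_eqI\<close> require a finite set of values; this
  lemma and the next two supply it by bounding the candidates by a powerset.\<close>

lemma finite_independent_sets:
  assumes "finite (verts D)"
  shows "finite {S. independent_set D S}"
  by (rule finite_subset[of _ "Pow (verts D)"]) (use assms in \<open>auto simp: independent_set_def\<close>)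

lemma finite_independent_partitions:
  assumes "finite (verts D)"
  shows "finite {P. independent_partition D P}"
  by (rule finite_subset[of _ "Pow (Pow (verts D))"])
    (use assms in \<open>auto simp: independent_partition_def partition_on_def\<close>)

lemma finite_dominating_sets:
  assumes "finite (verts D)"
  shows "finite {S. dominating_set D S}"
  by (rule finite_subset[of _ "Pow (verts D)"]) (use assms in \<open>auto simp: dominating_set_def\<close>)

lemma independence_number_eqI:
  assumes "finite (verts D)" "independent_set D S" "card S = n"
    and "\<And>S. independent_set D S \<Longrightarrow> card S \<le> n"
  shows "independence_number D = n"
  unfolding independence_number_def
  by (rule Max_eqI) (use assms finite_independent_sets in auto)

lemma chromatic_number_eqI:
  assumes "finite (verts D)" "independent_partition D P" "card P = n"
    and "\<And>P. independent_partition D P \<Longrightarrow> n \<le> card P"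
  shows "chromatic_number D = n"
  unfolding chromatic_number_def
  by (rule Min_eqI) (use assms finite_independent_partitions in auto)

lemma domination_number_eqI:
  assumes "finite (verts D)" "dominating_set D S" "card S = n"
    and "\<And>S. dominating_set D S \<Longrightarrow> n \<le> card S"
  shows "domination_number D = n"
  unfolding domination_number_def
  by (rule Min_eqI) (use assms finite_dominating_sets in auto)

text \<open>Two distinct vertices of the clique \<open>K\<close> never share an independent part, so
  sending each vertex of \<open>K\<close> to a part containing it is injective.\<close>

lemma clique_le_card_independent_partition:
  assumes P: "independent_partition D P" and K: "K \<subseteq> verts D"
    and adj: "\<And>u v. u \<in> K \<Longrightarrow> v \<in> K \<Longrightarrow> u \<noteq> v \<Longrightarrow> (u, v) \<in> arcs_ends D \<or> (v, u) \<in> arcs_ends D"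
  shows "card K \<le> card P"
proof -
  have "\<forall>u\<in>K. \<exists>X\<in>P. u \<in> X"
    using P K by (auto simp: independent_partition_def partition_on_def)
  then obtain f where f: "\<And>u. u \<in> K \<Longrightarrow> f u \<in> P \<and> u \<in> f u"
    by metis
  have "inj_on f K"
  proof (rule inj_onI, rule ccontr)
    fix u v assume uv: "u \<in> K" "v \<in> K" "f u = f v" "u \<noteq> v"
    have "independent_set D (f u)"
      using P f uv(1) by (auto simp: independent_partition_def)
    moreover have "u \<in> f u" "v \<in> f u"
      using f uv by metis+
    ultimately show False
      using adj uv unfolding independent_set_def by blast
  qed
  moreover have "finite P" "f ` K \<subseteq> P"
    using P f by (auto simp: independent_partition_def)
  ultimately show ?thesis
    by (metis card_inj_on_le)
qed

text \<open>The witness is the last arc: the induction passes it on from the tail of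
  \<open>p\<close>, and when that tail is empty the head of the single arc is
  \<open>v\<close>.\<close>

lemma (in pre_digraph) cas_imp_in_arc:
  "cas u p v \<Longrightarrow> p \<noteq> [] \<Longrightarrow> \<exists>e\<in>set p. head G e = v"
  by (induction p arbitrary: u) (auto, metis cas.simps(1))

text \<open>The tree reaches \<open>v\<close> from the root by a path, and the last arc of this path
  enters \<open>v\<close>.\<close>

lemma directed_spanning_tree_imp_in_arc:
  assumes T: "directed_spanning_tree D T r" and v: "v \<in> verts D" "v \<noteq> r"
  shows "\<exists>u. (u, v) \<in> arcs_ends D"
proof -
  obtain p where "pre_digraph.apath T r p v"
    using T v unfolding directed_spanning_tree_def by blast
  then have "set p \<subseteq> arcs T" "pre_digraph.cas T r p v"
    by (auto simp: pre_digraph.apath_def pre_digraph.awalk_def)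
  \<comment> \<open>An empty walk ends at its start, which would force \<open>v = r\<close>.\<close>
  moreover have "p \<noteq> []"
    using calculation v by (auto simp: pre_digraph.cas.simps)
  ultimately obtain e where e: "e \<in> arcs T" "head T e = v"
    using pre_digraph.cas_imp_in_arc by (metis subsetD)
  have "subgraph T D"
    using T by (auto simp: directed_spanning_tree_def spanning_def)
  \<comment> \<open>Compatibility of a subgraph makes \<open>T\<close> and \<open>D\<close> agree on
    heads.\<close>
  then have "e \<in> arcs D" "head D e = v"
    using e by (auto simp: subgraph_def compatible_def)
  then show ?thesis
    by (auto simp: arcs_ends_def arc_to_ends_def)
qed

text \<open>At least one of \<open>s\<close> and \<open>t\<close> differs from the root and would
  need an incoming arc.\<close>

lemma no_directed_spanning_tree_two_sources:
  assumes "s \<in> verts D" "t \<in> verts D" "s \<noteq> t"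
    and "\<And>u. (u, s) \<notin> arcs_ends D" "\<And>u. (u, t) \<notin> arcs_ends D"
  shows "\<not> has_directed_spanning_tree D"
  using assms directed_spanning_tree_imp_in_arc unfolding has_directed_spanning_tree_def by metis

lemma source_in_dominating_set:
  assumes "dominating_set D S" "s \<in> verts D" "\<And>u. (u, s) \<notin> arcs_ends D"
  shows "s \<in> S"
  using assms by (auto simp: dominating_set_def)

lemma verts_D4: "verts D4 = {v1, v2, v3, v4, v5, v6}"
  by (simp add: D4_def)

lemma arcs_ends_D4:
  "arcs_ends D4 = {(v2, v1), (v2, v3), (v4, v1), (v4, v3), (v5, v2), (v5, v3), (v5, v4),
    (v6, v1), (v6, v2), (v6, v3)}"
  by (simp add: D4_def arcs_ends_def arc_to_ends_def)

lemma finite_verts_D4: "finite (verts D4)"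
  by (simp add: verts_D4)

text \<open>The classes are every second edge of the path \<open>v3\<close>, \<open>v1\<close>,
  \<open>v5\<close>, \<open>v6\<close>, \<open>v4\<close>, \<open>v2\<close> of non-adjacent
  pairs.\<close>

lemma independent_partition_D4: "independent_partition D4 {{v1, v3}, {v2, v4}, {v5, v6}}"
  by (auto simp: independent_partition_def partition_on_def disjoint_def independent_set_def
      verts_D4 arcs_ends_D4)

lemma card_colour_classes_D4: "card {{v1, v3}, {v2, v4}, {v5, v6}} = 3"
  by (simp add: doubleton_eq_iff)

lemma perfect_matching_D4: "perfect_matching D4 {(v2, v3), (v5, v4), (v6, v1)}"
  by (auto simp: perfect_matching_def matching_def D4_def)

lemma independent_set_D4_subset:
  assumes "independent_set D4 S"
  shows "S \<subseteq> {v1, v3} \<or> S \<subseteq> {v1, v5} \<or> S \<subseteq> {v5, v6} \<or> S \<subseteq> {v4, v6} \<or> S \<subseteq> {v2, v4}"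
proof -
  have "\<forall>(u, v)\<in>arcs_ends D4. u \<notin> S \<or> v \<notin> S"
    using assms by (auto simp: independent_set_def)
  \<comment> \<open>One clause per arc: what remains is propositional reasoning about which of the
    six vertices lie in \<open>S\<close>.\<close>
  then have "v2 \<notin> S \<or> v1 \<notin> S" "v2 \<notin> S \<or> v3 \<notin> S" "v4 \<notin> S \<or> v1 \<notin> S" "v4 \<notin> S \<or> v3 \<notin> S"
    "v5 \<notin> S \<or> v2 \<notin> S" "v5 \<notin> S \<or> v3 \<notin> S" "v5 \<notin> S \<or> v4 \<notin> S"
    "v6 \<notin> S \<or> v1 \<notin> S" "v6 \<notin> S \<or> v2 \<notin> S" "v6 \<notin> S \<or> v3 \<notin> S"
    unfolding arcs_ends_D4 by simp_all
  moreover have "S \<subseteq> {v1, v2, v3, v4, v5, v6}"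
    using assms by (simp add: independent_set_def verts_D4)
  ultimately show ?thesis
    by (smt (verit) insert_iff subset_iff)
qed

lemma independence_number_D4: "independence_number D4 = 2"
proof (rule independence_number_eqI[OF finite_verts_D4])
  show "independent_set D4 {v1, v3}"
    by (simp add: independent_set_def verts_D4 arcs_ends_D4)
  fix S assume "independent_set D4 S"
  then obtain x y where "S \<subseteq> {x, y}"
    using independent_set_D4_subset by meson
  then show "card S \<le> 2"
    \<comment> \<open>The split is needed because \<open>{x, y}\<close> has two elements only if
      \<open>x\<close> and \<open>y\<close> differ.\<close>
    using card_mono[of "{x, y}" S] card_2_iff[of "{x, y}"] by (cases "x = y") auto
qed simp

lemma chromatic_number_D4: "chromatic_number D4 = 3"
proof (rule chromatic_number_eqI[OF finite_verts_D4 independent_partition_D4 card_colour_classes_D4])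
  fix P assume "independent_partition D4 P"
  then have "card {v1, v2, v6} \<le> card P"
    by (rule clique_le_card_independent_partition) (auto simp: verts_D4 arcs_ends_D4)
  then show "3 \<le> card P"
    by simp
qed

lemma domination_number_D4: "domination_number D4 = 2"
proof (rule domination_number_eqI[OF finite_verts_D4])
  show "dominating_set D4 {v5, v6}"
    by (auto simp: dominating_set_def verts_D4 arcs_ends_D4)
  fix S assume S: "dominating_set D4 S"
  then have "{v5, v6} \<subseteq> S"
    using source_in_dominating_set[OF S] by (simp add: verts_D4 arcs_ends_D4)
  moreover have "finite S"
    using S finite_verts_D4 by (auto simp: dominating_set_def intro: finite_subset)
  ultimately have "card {v5, v6} \<le> card S"
    by (metis card_mono)
  then show "2 \<le> card S"
    by simp
qed simp

lemma no_directed_spanning_tree_D4: "\<not> has_directed_spanning_tree D4"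
  by (rule no_directed_spanning_tree_two_sources[of v5 _ v6]) (simp_all add: verts_D4 arcs_ends_D4)

theorem theorem3p4:
  shows "multipartite 3 D4 \<and>
    (\<exists>M. perfect_matching D4 M) \<and>
    independence_number D4 = 2 \<and>
    chromatic_number D4 = 3 \<and>
    \<not> has_directed_spanning_tree D4 \<and>
    domination_number D4 = 2"
  using independent_partition_D4 card_colour_classes_D4 perfect_matching_D4 independence_number_D4
    chromatic_number_D4 no_directed_spanning_tree_D4 domination_number_D4
  unfolding multipartite_def by blast

end
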